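(* Let $\mathbb{F}$ be a field. For each $n \ge 1$, any $\alpha \in \mathbb{F}$ and any $\beta \in \mathbb{F}\setminus\{0\}$, with $k = \lceil n/2 \rceil$, the polynomial $\alpha S_n^n + \beta S_n^{n-1}$ can be written as a sum of at most $k$ read-once polynomials, but cannot be written as a sum of at most $k-1$ read-once polynomials.
   Context: $S_n^k(x_1,\ldots,x_n) = \sum_{A\subseteq[n],|A|=k}\prod_{i\in A}x_i$ is the $n$-variate elementary symmetric polynomial of degree $k$. A read-once formula (ROF) over a field $\mathbb{F}$ in variables $x_1,\ldots,x_n$ is a binary tree whose leaves are labeled by variables and whose internal nodes are labeled by $+$ or $\times$; every node additionally carries a pair $(\alpha,\beta) \in \mathbb{F}^2$, and each variable labels at most one leaf. A leaf labeled $x_i$ with pair $(\alpha,\beta)$ computes $\alpha x_i + \beta$; an internal node labeled $\star \in \{+,\times\}$ with pair $(\alpha,\beta)$ whose children compute $f_1,f_2$ computes $\alpha(f_1 \star f_2) + \beta$. A read-once polynomial (ROP) is a polynomial computed by some ROF (constants are also regarded as ROPs). *)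

theory Defs
  imports Complex_Main "HOL-Library.Poly_Mapping"
begin

text \<open>
  Formal multivariate polynomials: finitely supported maps from exponent vectors to coefficients,
  with the convolution product of \<^theory>\<open>HOL-Library.Poly_Mapping\<close>. Variables are indexed by
  natural numbers; the polynomials in n variables use the indices 1, ..., n.
\<close>

type_synonym 'a mpoly = "(nat \<Rightarrow>\<^sub>0 nat) \<Rightarrow>\<^sub>0 'a"

definition Const :: "'a \<Rightarrow> 'a::field mpoly" where
  "Const c = Poly_Mapping.single 0 c"

definition Var :: "nat \<Rightarrow> 'a::field mpoly" where
  "Var i = Poly_Mapping.single (Poly_Mapping.single i 1) 1"

definition elem_sym :: "nat \<Rightarrow> nat \<Rightarrow> 'a::field mpoly" where
  "elem_sym n k = (\<Sum>A\<in>{A. A \<subseteq> {1..n} \<and> card A = k}. \<Prod>i\<in>A. Var i)"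

datatype 'a formula =
    Leaf nat 'a 'a
  | Plus 'a 'a "'a formula" "'a formula"
  | Times 'a 'a "'a formula" "'a formula"

primrec formula_poly :: "'a::field formula \<Rightarrow> 'a mpoly" where
  "formula_poly (Leaf i a b) = Const a * Var i + Const b"
| "formula_poly (Plus a b \<phi> \<psi>) = Const a * (formula_poly \<phi> + formula_poly \<psi>) + Const b"
| "formula_poly (Times a b \<phi> \<psi>) = Const a * (formula_poly \<phi> * formula_poly \<psi>) + Const b"

primrec leaf_vars :: "'a formula \<Rightarrow> nat list" where
  "leaf_vars (Leaf i a b) = [i]"
| "leaf_vars (Plus a b \<phi> \<psi>) = leaf_vars \<phi> @ leaf_vars \<psi>"
| "leaf_vars (Times a b \<phi> \<psi>) = leaf_vars \<phi> @ leaf_vars \<psi>"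

definition is_rof :: "nat \<Rightarrow> 'a formula \<Rightarrow> bool" where
  "is_rof n \<phi> \<longleftrightarrow> distinct (leaf_vars \<phi>) \<and> set (leaf_vars \<phi>) \<subseteq> {1..n}"

definition is_rop :: "nat \<Rightarrow> 'a::field mpoly \<Rightarrow> bool" where
  "is_rop n p \<longleftrightarrow> (\<exists>c. p = Const c) \<or> (\<exists>\<phi>. is_rof n \<phi> \<and> p = formula_poly \<phi>)"

definition sum_of_at_most_rops :: "nat \<Rightarrow> nat \<Rightarrow> 'a::field mpoly \<Rightarrow> bool" where
  "sum_of_at_most_rops n m p \<longleftrightarrow>
     (\<exists>ps. length ps \<le> m \<and> (\<forall>q\<in>set ps. is_rop n q) \<and> p = sum_list ps)"

end

theory Submission
  imports Defs
begin

text \<open>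
  Everything in the lower bound happens for polynomial functions. For each variable the operations
  \<open>x\<^sub>i g + h \<mapsto> g + t h\<close> (derivatives and substitutions of nonzero values, up to scaling) preserve
  read-once functions and turn \<open>\<alpha> S\<^sub>n\<^sup>n + \<beta> S\<^sub>n\<^sup>n\<^sup>-\<^sup>1\<close> into a polynomial of the same form in one variable
  less, with the same \<open>\<beta>\<close>. A read-once function either is annihilated by two such operations on
  different variables, or contains no monomial omitting exactly one variable. In a representation
  of \<open>\<alpha> S\<^sub>n\<^sup>n + \<beta> S\<^sub>n\<^sup>n\<^sup>-\<^sup>1\<close> the second case cannot hold for all summands since \<open>\<beta> \<noteq> 0\<close>, so two variables
  can be traded for one summand, and induction gives more than \<open>(n - 1)/2\<close> summands.

  For the upper bound, group the \<open>n\<close> products of \<open>S\<^sub>n\<^sup>n\<^sup>-\<^sup>1\<close> in pairs: for \<open>\<alpha> \<noteq> 0\<close>,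
  \<open>\<alpha> x y + \<beta> (x + y) = \<alpha> (x + \<beta>/\<alpha>) (y + \<beta>/\<alpha>) - \<beta>\<^sup>2/\<alpha>\<close> is read-once.
\<close>

section \<open>Evaluation of formal polynomials\<close>

definition meval :: "(nat \<Rightarrow> 'a::field) \<Rightarrow> (nat \<Rightarrow>\<^sub>0 nat) \<Rightarrow> 'a" where
  "meval v m = (\<Prod>i\<in>Poly_Mapping.keys m. v i ^ Poly_Mapping.lookup m i)"

definition peval :: "'a::field mpoly \<Rightarrow> (nat \<Rightarrow> 'a) \<Rightarrow> 'a" where
  "peval p v = (\<Sum>m\<in>Poly_Mapping.keys p. Poly_Mapping.lookup p m * meval v m)"

lemma meval_superset:
  assumes "finite A" "Poly_Mapping.keys m \<subseteq> A"
  shows "meval v m = (\<Prod>i\<in>A. v i ^ Poly_Mapping.lookup m i)"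
  unfolding meval_def
  by (rule prod.mono_neutral_left) (use assms in \<open>auto simp: in_keys_iff\<close>)

lemma meval_add: "meval v (m + m') = meval v m * meval v m'"
proof -
  let ?A = "Poly_Mapping.keys m \<union> Poly_Mapping.keys m'"
  have "meval v (m + m') = (\<Prod>i\<in>?A. v i ^ Poly_Mapping.lookup (m + m') i)"
    by (rule meval_superset) (use Poly_Mapping.keys_add[of m m'] in auto)
  also have "\<dots> = meval v m * meval v m'"
    by (simp add: meval_superset[of ?A m] meval_superset[of ?A m'] lookup_add power_add
        prod.distrib)
  finally show ?thesis .
qed

lemma peval_superset:
  assumes "finite A" "Poly_Mapping.keys p \<subseteq> A"
  shows "peval p v = (\<Sum>m\<in>A. Poly_Mapping.lookup p m * meval v m)"
  unfolding peval_def
  by (rule sum.mono_neutral_left) (use assms in \<open>auto simp: in_keys_iff\<close>)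

lemma peval_single: "peval (Poly_Mapping.single m c) v = c * meval v m"
  by (subst peval_superset[of "{m}"]) auto

lemma peval_add: "peval (p + q) v = peval p v + peval q v"
proof -
  let ?A = "Poly_Mapping.keys p \<union> Poly_Mapping.keys q"
  have "peval (p + q) v = (\<Sum>m\<in>?A. Poly_Mapping.lookup (p + q) m * meval v m)"
    by (rule peval_superset) (use Poly_Mapping.keys_add[of p q] in auto)
  also have "\<dots> = peval p v + peval q v"
    by (simp add: peval_superset[of ?A p] peval_superset[of ?A q] lookup_add distrib_right
        sum.distrib)
  finally show ?thesis .
qed

lemma peval_0: "peval 0 v = 0"
  by (simp add: peval_def)

lemma peval_sum: "peval (\<Sum>x\<in>A. f x) v = (\<Sum>x\<in>A. peval (f x) v)"
  by (induction A rule: infinite_finite_induct) (auto simp: peval_0 peval_add)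

lemma poly_mapping_eq_sum_single:
  "p = (\<Sum>m\<in>Poly_Mapping.keys p. Poly_Mapping.single m (Poly_Mapping.lookup p m))"
  by (rule poly_mapping_eqI)
    (auto simp: lookup_sum lookup_single when_def in_keys_iff sum.delta')

lemma peval_mult: "peval (p * q) v = peval p v * peval q v"
proof -
  let ?s = "\<lambda>p m. Poly_Mapping.single m (Poly_Mapping.lookup p m)"
  have "peval (p * q) v =
      peval ((\<Sum>m\<in>Poly_Mapping.keys p. ?s p m) * (\<Sum>m\<in>Poly_Mapping.keys q. ?s q m)) v"
    using poly_mapping_eq_sum_single[of p] poly_mapping_eq_sum_single[of q] by simp
  also have "\<dots> = peval p v * peval q v"
    by (simp add: sum_product peval_sum mult_single peval_single meval_add peval_def[of p] peval_def[of q]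
        algebra_simps)
  finally show ?thesis .
qed

lemma peval_Const: "peval (Const c) v = c"
  by (simp add: Const_def peval_single meval_def)

lemma peval_Var: "peval (Var i) v = v i"
  by (simp add: Var_def peval_single meval_def)

lemma peval_prod_Var: "peval (\<Prod>i\<in>A. Var i) v = (\<Prod>i\<in>A. v i)"
proof -
  have "peval 1 v = 1"
    using peval_Const[of 1 v] by (simp add: Const_def single_one)
  then show ?thesis
    by (induction A rule: infinite_finite_induct) (auto simp: peval_mult peval_Var)
qed

lemma peval_sum_list: "peval (sum_list ps) v = (\<Sum>p\<leftarrow>ps. peval p v)"
  by (induction ps) (auto simp: peval_0 peval_add)

lemma elem_sym_full: "elem_sym n n = (\<Prod>i\<in>{1..n}. Var i)"
proof -
  have "{A. A \<subseteq> {1..n} \<and> card A = n} = {{1..n}}"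
    using card_subset_eq[of "{1..n}"] by auto
  then show ?thesis by (simp add: elem_sym_def)
qed

text \<open>The subsets of size \<open>n - 1\<close> are the complements of single indices. For
  \<open>n = 0\<close> truncated subtraction would make the left side 1 and the right side
  0.\<close>

lemma elem_sym_pred:
  assumes "n \<ge> 1"
  shows "elem_sym n (n - 1) = (\<Sum>i\<in>{1..n}. \<Prod>j\<in>{1..n} - {i}. Var j)"
proof -
  have "{A. A \<subseteq> {1..n} \<and> card A = n - 1} = (\<lambda>i. {1..n} - {i}) ` {1..n}"
  proof (intro equalityI subsetI)
    fix A assume "A \<in> {A. A \<subseteq> {1..n} \<and> card A = n - 1}"
    then have A: "A \<subseteq> {1..n}" "card A = n - 1" by auto
    then have "card ({1..n} - A) = 1"
      using assms by (subst card_Diff_subset) (auto intro: finite_subset)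
    then obtain i where "{1..n} - A = {i}" by (auto simp: card_1_singleton_iff)
    then have "i \<in> {1..n}" "A = {1..n} - {i}" using A by auto
    then show "A \<in> (\<lambda>i. {1..n} - {i}) ` {1..n}" by blast
  qed (use assms in auto)
  moreover have "inj_on (\<lambda>i. {1..n} - {i}) {1..n}"
    by (auto simp: inj_on_def)
  ultimately show ?thesis
    by (simp add: elem_sym_def sum.reindex)
qed

section \<open>Read-once functions\<close>

text \<open>The semantic counterpart of a read-once formula; node labels become sums and products
  with constants. A constant may claim any \<open>S\<close>, so \<open>S\<close> only bounds the
  variables read, and adding a zero enlarges it. Constants are also what \<open>slice\<close> makes
  of a leaf.\<close>

inductive read_once :: "nat set \<Rightarrow> ((nat \<Rightarrow> 'a::field) \<Rightarrow> 'a) \<Rightarrow> bool" where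
  const: "read_once S (\<lambda>_. c)"
| var: "read_once {i} (\<lambda>v. v i)"
| add: "read_once S f \<Longrightarrow> read_once T g \<Longrightarrow> S \<inter> T = {} \<Longrightarrow> read_once (S \<union> T) (\<lambda>v. f v + g v)"
| mult: "read_once S f \<Longrightarrow> read_once T g \<Longrightarrow> S \<inter> T = {} \<Longrightarrow> read_once (S \<union> T) (\<lambda>v. f v * g v)"

lemma read_once_mono:
  assumes "read_once S f" "S \<subseteq> T"
  shows "read_once T f"
  using read_once.add[OF assms(1) read_once.const[of "T - S" 0]] assms(2)
  by (simp add: Un_absorb1)

lemma read_once_cmult: "read_once S f \<Longrightarrow> read_once S (\<lambda>v. c * f v)"
  using read_once.mult[OF read_once.const[of "{}" c]] by simp

lemma read_once_add_const: "read_once S f \<Longrightarrow> read_once S (\<lambda>v. f v + c)"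
  using read_once.add[OF _ read_once.const[of "{}" c]] by simp

lemma read_once_cong:
  "read_once S f \<Longrightarrow> (\<And>i. i \<in> S \<Longrightarrow> v i = w i) \<Longrightarrow> f v = f w"
proof (induction arbitrary: v w rule: read_once.induct)
  case (add S f T g)
  then show ?case by (metis UnCI)
next
  case (mult S f T g)
  then show ?case by (metis UnCI)
qed auto

lemma read_once_formula:
  "distinct (leaf_vars \<phi>) \<Longrightarrow> read_once (set (leaf_vars \<phi>)) (peval (formula_poly \<phi>))"
proof (induction \<phi>)
  case (Leaf i a b)
  have "peval (formula_poly (Leaf i a b)) = (\<lambda>v. a * v i + b)"
    by (simp add: fun_eq_iff peval_add peval_mult peval_Const peval_Var)
  then show ?case
    using read_once_add_const[OF read_once_cmult[OF read_once.var[of i]], of a b] by simp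
next
  case (Plus a b \<phi> \<psi>)
  have "peval (formula_poly (Plus a b \<phi> \<psi>)) =
      (\<lambda>v. a * (peval (formula_poly \<phi>) v + peval (formula_poly \<psi>) v) + b)"
    by (simp add: fun_eq_iff peval_add peval_mult peval_Const)
  with Plus show ?case
    using read_once_add_const[OF read_once_cmult[OF read_once.add], of _ _ _ _ a b] by simp
next
  case (Times a b \<phi> \<psi>)
  have "peval (formula_poly (Times a b \<phi> \<psi>)) =
      (\<lambda>v. a * (peval (formula_poly \<phi>) v * peval (formula_poly \<psi>) v) + b)"
    by (simp add: fun_eq_iff peval_add peval_mult peval_Const)
  with Times show ?case
    using read_once_add_const[OF read_once_cmult[OF read_once.mult], of _ _ _ _ a b] by simp
qed

lemma read_once_is_rop:
  assumes "is_rop n p"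
  shows "read_once {1..n} (peval p)"
proof -
  have "peval (Const c) = (\<lambda>_. c)" for c :: 'a
    by (simp add: fun_eq_iff peval_Const)
  with assms show ?thesis
    by (auto simp: is_rop_def is_rof_def intro: read_once_mono[OF read_once_formula]
        read_once.const)
qed

lemma read_once_singleton:
  assumes "read_once {i} f"
  shows "\<exists>a b. f = (\<lambda>v. a * v i + b)"
proof -
  \<comment> \<open>The induction runs over all subsets of \<open>{i}\<close>: of two disjoint ones,
    one is empty and its factor constant, so no square of \<open>v i\<close> arises.\<close>
  have "\<exists>a b. f = (\<lambda>v. a * v i + b)" if "read_once S f" "S \<subseteq> {i}" for S f
    using that
  proof (induction rule: read_once.induct)
    case (const S c)
    show ?case by (rule exI[of _ 0]) auto
  next
    case (var j)
    then show ?case by (intro exI[of _ 1] exI[of _ 0]) auto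
  next
    case (add S f T g)
    then obtain a b c d where "f = (\<lambda>v. a * v i + b)" "g = (\<lambda>v. c * v i + d)" by auto
    then show ?case by (intro exI[of _ "a + c"] exI[of _ "b + d"]) (auto simp: algebra_simps)
  next
    case (mult S f T g)
    then obtain a b c d where f: "f = (\<lambda>v. a * v i + b)" and g: "g = (\<lambda>v. c * v i + d)"
      by auto
    have "S = {} \<or> T = {}" using mult.hyps mult.prems by auto
    then show ?case
    proof
      assume "S = {}"
      then have "f v = f (\<lambda>_. 0)" for v by (intro read_once_cong[OF mult.hyps(1)]) auto
      then have "f v = b" for v unfolding f by simp
      then show ?thesis
        unfolding g by (intro exI[of _ "b * c"] exI[of _ "b * d"]) (auto simp: algebra_simps)
    next
      assume "T = {}"
      then have "g v = g (\<lambda>_. 0)" for v by (intro read_once_cong[OF mult.hyps(2)]) auto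
      then have "g v = d" for v unfolding g by simp
      then show ?thesis
        unfolding f by (intro exI[of _ "a * d"] exI[of _ "b * d"]) (auto simp: algebra_simps)
    qed
  qed
  with assms show ?thesis by auto
qed

section \<open>Partial evaluations and top coefficients\<close>

text \<open>On a function \<open>x\<^sub>i g + h\<close> that is affine in \<open>x\<^sub>i\<close>, this is \<open>g + t h\<close>: the partial derivative
  for \<open>t = 0\<close>, and \<open>t\<close> times the substitution \<open>x\<^sub>i := 1/t\<close> otherwise.\<close>

definition slice :: "nat \<Rightarrow> 'a \<Rightarrow> ((nat \<Rightarrow> 'a::field) \<Rightarrow> 'a) \<Rightarrow> (nat \<Rightarrow> 'a) \<Rightarrow> 'a" where
  "slice i t f v = t * f (v(i := 0)) + (f (v(i := 1)) - f (v(i := 0)))"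

lemma slice_const: "slice i t (\<lambda>_. c) = (\<lambda>_. t * c)"
  by (simp add: slice_def fun_eq_iff)

lemma slice_add: "slice i t (\<lambda>v. f v + g v) = (\<lambda>v. slice i t f v + slice i t g v)"
  by (simp add: slice_def fun_eq_iff algebra_simps)

lemma slice_indep:
  assumes "read_once S f" "i \<notin> S"
  shows "slice i t f = (\<lambda>v. t * f v)"
proof
  fix v
  have "f (v(i := x)) = f v" for x
    by (rule read_once_cong[OF assms(1)]) (use assms(2) in auto)
  then show "slice i t f v = t * f v" by (simp add: slice_def)
qed

lemma slice_mult_left:
  assumes "read_once T g" "i \<notin> T"
  shows "slice i t (\<lambda>v. f v * g v) = (\<lambda>v. slice i t f v * g v)"
proof
  fix v
  have "g (v(i := x)) = g v" for x
    by (rule read_once_cong[OF assms(1)]) (use assms(2) in auto)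
  then show "slice i t (\<lambda>v. f v * g v) v = slice i t f v * g v"
    by (simp add: slice_def algebra_simps)
qed

lemma slice_mult_right:
  assumes "read_once S f" "i \<notin> S"
  shows "slice i t (\<lambda>v. f v * g v) = (\<lambda>v. f v * slice i t g v)"
  using slice_mult_left[OF assms, of t g] by (simp add: mult.commute)

text \<open>At a product gate at most one factor depends on \<open>i\<close>, so the operation acts
  on that factor alone and no product rule arises.\<close>

lemma read_once_slice: "read_once S f \<Longrightarrow> read_once (S - {i}) (slice i t f)"
proof (induction rule: read_once.induct)
  case (const S c)
  show ?case by (simp add: slice_const read_once.const)
next
  case (var j)
  show ?case
  proof (cases "j = i")
    case True
    then have "slice i t (\<lambda>v. v j) = (\<lambda>_. 1)" by (simp add: slice_def fun_eq_iff)
    then show ?thesis by (simp add: read_once.const)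
  next
    case False
    then show ?thesis
      using read_once_cmult[OF read_once.var[of j], of t] slice_indep[OF read_once.var[of j], of i t]
      by auto
  qed
next
  case (add S f T g)
  then show ?case
    unfolding slice_add Un_Diff by (intro read_once.add) auto
next
  case (mult S f T g)
  consider "i \<notin> S" | "i \<notin> T" using mult.hyps by auto
  then show ?case
  proof cases
    case 1
    have "read_once (S \<union> (T - {i})) (\<lambda>v. f v * slice i t g v)"
      using mult by (intro read_once.mult) auto
    with 1 show ?thesis
      by (simp add: slice_mult_right[OF mult.hyps(1)] Un_Diff)
  next
    case 2
    have "read_once ((S - {i}) \<union> T) (\<lambda>v. slice i t f v * g v)"
      using mult by (intro read_once.mult) auto
    with 2 show ?thesis
      by (simp add: slice_mult_left[OF mult.hyps(2)] Un_Diff)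
  qed
qed

text \<open>For a multilinear \<open>f\<close> this is the coefficient of \<open>\<Prod>i\<in>S. x\<^sub>i\<close>, by Moebius inversion over
  the 0/1-points.\<close>

definition top_coeff :: "nat set \<Rightarrow> ((nat \<Rightarrow> 'a::field) \<Rightarrow> 'a) \<Rightarrow> 'a" where
  "top_coeff S f = (\<Sum>T\<in>Pow S. (-1) ^ card (S - T) * f (\<lambda>i. if i \<in> T then 1 else 0))"

lemma top_coeff_empty: "top_coeff {} f = f (\<lambda>_. 0)"
  by (simp add: top_coeff_def)

lemma top_coeff_add: "top_coeff S (\<lambda>v. f v + g v) = top_coeff S f + top_coeff S g"
  by (simp add: top_coeff_def algebra_simps sum.distrib)

lemma top_coeff_cmult: "top_coeff S (\<lambda>v. c * f v) = c * top_coeff S f"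
  by (simp add: top_coeff_def sum_distrib_left algebra_simps)

text \<open>Subsets with and without a fixed \<open>i\<close> pair up with opposite signs.\<close>

lemma top_coeff_const:
  assumes "finite S" "S \<noteq> {}"
  shows "top_coeff S (\<lambda>_. c) = 0"
proof -
  obtain i where i: "i \<in> S" using assms by auto
  define R where "R = S - {i}"
  have S: "S = insert i R" "i \<notin> R" "finite R" using i assms by (auto simp: R_def)
  have "card (insert i R - T) = Suc (card (R - T))" "insert i R - insert i T = R - T"
    if "T \<subseteq> R" for T
    using that S by (auto simp: insert_Diff_if)
  moreover have "inj_on (insert i) (Pow R)" "Pow R \<inter> insert i ` Pow R = {}"
    using S(2) by (auto simp: inj_on_def)
  ultimately show ?thesis
    unfolding top_coeff_def S(1) Pow_insert using S
    by (subst sum.union_disjoint) (simp_all add: sum.reindex sum_negf flip: sum.distrib)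
qed

text \<open>Subsets of \<open>S \<union> T\<close> split uniquely into a part in \<open>S\<close>,
  seen only by \<open>f\<close>, and a part in \<open>T\<close>, seen only by \<open>g\<close>; the
  signs multiply accordingly.\<close>

lemma top_coeff_mult:
  assumes f: "read_once A f" and g: "read_once B g" and "A \<inter> B = {}"
    and "S \<subseteq> A" "T \<subseteq> B" "finite S" "finite T"
  shows "top_coeff (S \<union> T) (\<lambda>v. f v * g v) = top_coeff S f * top_coeff T g"
proof -
  let ?ind = "\<lambda>U i. if i \<in> U then 1 else (0::'a)"
  let ?h = "\<lambda>(U, V). (-1) ^ card (S - U) * f (?ind U) * ((-1) ^ card (T - V) * g (?ind V))"
  have disj: "x \<notin> T" if "x \<in> S" for x using assms that by auto
  have "top_coeff (S \<union> T) (\<lambda>v. f v * g v) = (\<Sum>p\<in>Pow S \<times> Pow T. ?h p)"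
    unfolding top_coeff_def
  proof (rule sum.reindex_bij_witness[of _ "\<lambda>(U, V). U \<union> V" "\<lambda>W. (W \<inter> S, W \<inter> T)"], goal_cases)
    case (5 W)
    have "f (?ind (W \<inter> S)) = f (?ind W)"
      by (rule read_once_cong[OF f]) (use 5 assms in auto)
    moreover have "g (?ind (W \<inter> T)) = g (?ind W)"
      by (rule read_once_cong[OF g]) (use 5 assms in auto)
    moreover have "card (S \<union> T - W) = card (S - W \<inter> S) + card (T - W \<inter> T)"
      using assms by (subst card_Un_disjoint[symmetric]) (auto intro!: arg_cong[of _ _ card])
    ultimately show ?case by (simp add: power_add)
  qed (use disj in auto)
  also have "\<dots> = top_coeff S f * top_coeff T g"
    by (simp add: top_coeff_def sum_product sum.cartesian_product)
  finally show ?thesis .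
qed

section \<open>Lower bound\<close>

text \<open>The outer operation is a derivative, so additive constants die and annihilation survives
  shifts. The inner \<open>t\<close> is free, to match the constant of a leaf below a product
  gate.\<close>

definition annihilated :: "nat set \<Rightarrow> ((nat \<Rightarrow> 'a::field) \<Rightarrow> 'a) \<Rightarrow> bool" where
  "annihilated S f \<longleftrightarrow> (\<exists>i\<in>S. \<exists>j\<in>S. i \<noteq> j \<and> (\<exists>t. slice i 0 (slice j t f) = (\<lambda>_. 0)))"

lemma annihilatedI:
  "i \<in> S \<Longrightarrow> j \<in> S \<Longrightarrow> i \<noteq> j \<Longrightarrow> slice i 0 (slice j t f) = (\<lambda>_. 0) \<Longrightarrow> annihilated S f"
  unfolding annihilated_def by blast

lemma annihilated_add_const:
  assumes "annihilated S f"
  shows "annihilated S (\<lambda>v. f v + c)"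
proof -
  from assms obtain i j t where "i \<in> S" "j \<in> S" "i \<noteq> j" "slice i 0 (slice j t f) = (\<lambda>_. 0)"
    unfolding annihilated_def by blast
  then show ?thesis
    by (intro annihilatedI[of i S j t]) (auto simp: slice_add slice_const)
qed

lemma annihilated_mult:
  assumes "annihilated S f" "read_once T g" "S \<inter> T = {}"
  shows "annihilated (S \<union> T) (\<lambda>v. f v * g v)"
proof -
  from assms(1) obtain i j t where ij: "i \<in> S" "j \<in> S" "i \<noteq> j"
      "slice i 0 (slice j t f) = (\<lambda>_. 0)"
    unfolding annihilated_def by blast
  then have "i \<notin> T" "j \<notin> T" using assms(3) by auto
  then show ?thesis
    using ij by (intro annihilatedI[of i _ j t]) (auto simp: slice_mult_left[OF assms(2)])
qed

text \<open>The operation on \<open>i\<close> alone already kills the product; any \<open>j\<close>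
  in \<open>T\<close> then supplies the second variable.\<close>

lemma annihilated_mult_singleton:
  assumes "slice i t f = (\<lambda>_. 0)" "read_once T g" "i \<notin> T" "T \<noteq> {}"
  shows "annihilated (insert i T) (\<lambda>v. f v * g v)"
proof -
  from assms(4) obtain j where "j \<in> T" by auto
  then show ?thesis using assms
    by (intro annihilatedI[of j _ i t]) (auto simp: slice_mult_left[OF assms(2)] slice_const)
qed

text \<open>For \<open>f = a x + b\<close> the slice is \<open>a + t b\<close>, which vanishes at
  \<open>t = - a / b\<close>; if \<open>b = 0\<close>, the constant coefficient vanishes
  instead.\<close>

lemma read_once_singleton_cases:
  assumes "read_once {i} f"
  shows "(\<exists>t. slice i t f = (\<lambda>_. 0)) \<or> top_coeff {} f = 0"
proof -
  from read_once_singleton[OF assms] obtain a b where f: "f = (\<lambda>v. a * v i + b)" by blast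
  show ?thesis
  proof (cases "b = 0")
    case True
    then show ?thesis by (simp add: f top_coeff_empty)
  next
    case False
    then have "slice i (- a / b) f = (\<lambda>_. 0)" by (simp add: f slice_def fun_eq_iff)
    then show ?thesis by blast
  qed
qed

text \<open>A sum gate with variables \<open>i\<close>, \<open>j\<close> on its two sides gives \<open>\<partial>\<^sub>i\<partial>\<^sub>j f = 0\<close>. A product gate
  with a leaf \<open>x\<^sub>i + b\<close>, \<open>b \<noteq> 0\<close>, gives \<open>\<partial>\<^sub>j f = 0\<close> at \<open>x\<^sub>i = -b\<close> for every \<open>j\<close> on its other side. If
  neither occurs, no monomial omits exactly one variable.\<close>

lemma read_once_trichotomy:
  "read_once S f \<Longrightarrow> finite S \<Longrightarrow>
    annihilated S f \<or> (\<exists>i t. S = {i} \<and> slice i t f = (\<lambda>_. 0)) \<or>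
    (\<forall>i\<in>S. top_coeff (S - {i}) f = 0)"
proof (induction rule: read_once.induct)
  case (const S c)
  show ?case
  \<comment> \<open>For a singleton, \<open>top_coeff {}\<close> returns \<open>c\<close> itself, so
    the derivative is used instead. Otherwise no \<open>S - {i}\<close> is empty.\<close>
  proof (cases "\<exists>i. S = {i}")
    case True
    moreover have "slice i 0 (\<lambda>_. c) = (\<lambda>_. 0)" for i by (simp add: slice_const)
    ultimately show ?thesis by blast
  next
    case False
    then have "\<forall>i\<in>S. top_coeff (S - {i}) (\<lambda>_. c) = 0"
      using const by (intro ballI top_coeff_const) auto
    then show ?thesis by blast
  qed
next
  case (var i)
  then show ?case by (simp add: top_coeff_empty)
next
  case (add S f T g)
  have sum: "read_once (S \<union> T) (\<lambda>v. f v + g v)" using add.hyps by (intro read_once.add)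
  \<comment> \<open>Handles a side that reads nothing and thus only adds a constant. Outside
    singletons the first and third alternatives survive the shift; on a singleton they are rederived
    from the affine form.\<close>
  have shift: ?case
    if h: "annihilated R h \<or> (\<exists>i t. R = {i} \<and> slice i t h = (\<lambda>_. 0)) \<or>
        (\<forall>i\<in>R. top_coeff (R - {i}) h = 0)"
      and R: "S \<union> T = R" and fg: "(\<lambda>v. f v + g v) = (\<lambda>v. h v + c)" for R h c
  proof (cases "\<exists>i. R = {i}")
    case True
    then obtain i where i: "S \<union> T = {i}" using R by auto
    with sum have "(\<exists>t. slice i t (\<lambda>v. f v + g v) = (\<lambda>_. 0)) \<or> top_coeff {} (\<lambda>v. f v + g v) = 0"
      using read_once_singleton_cases by metis
    then show ?thesis unfolding i by auto
  next
    case False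
    have "top_coeff (R - {i}) (\<lambda>_. c) = 0" if "i \<in> R" for i
      using False that R add.prems by (intro top_coeff_const) auto
    then show ?thesis
      using h False annihilated_add_const[of R h c] unfolding R fg by (auto simp: top_coeff_add)
  qed
  consider "S = {}" | "T = {}" | i j where "i \<in> S" "j \<in> T" by auto
  then show ?case
  proof cases
    case 1
    have "f v = f (\<lambda>_. 0)" for v
      by (rule read_once_cong[OF add.hyps(1)]) (simp add: 1)
    then have "(\<lambda>v. f v + g v) = (\<lambda>v. g v + f (\<lambda>_. 0))"
      by (intro ext) (simp add: add.commute)
    then show ?thesis using add 1 by (intro shift[of T g]) auto
  next
    case 2
    have "g v = g (\<lambda>_. 0)" for v
      by (rule read_once_cong[OF add.hyps(2)]) (simp add: 2)
    then have "(\<lambda>v. f v + g v) = (\<lambda>v. f v + g (\<lambda>_. 0))" by metis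
    then show ?thesis using add 2 by (intro shift[of S f]) auto
  next
    case 3
    then have "i \<notin> T" "j \<notin> S" "i \<noteq> j" using add.hyps by auto
    then have "slice i 0 (slice j 0 (\<lambda>v. f v + g v)) = (\<lambda>_. 0)"
      using slice_indep[OF read_once_slice[OF add.hyps(2)], of i j 0 0]
      by (simp add: slice_add slice_indep[OF add.hyps(1)] slice_const)
    then show ?thesis using 3 \<open>i \<noteq> j\<close> annihilatedI[of i "S \<union> T" j 0] by auto
  qed
next
  case (mult S f T g)
  have swap: "(\<lambda>v. f v * g v) = (\<lambda>v. g v * f v)" by (simp add: mult.commute)
  have fin: "finite S" "finite T" using mult.prems by auto
  note mult_f = annihilated_mult[OF _ mult.hyps(2) mult.hyps(3)]
    and mult_g = annihilated_mult[OF _ mult.hyps(1), of T g]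
  \<comment> \<open>Each \<open>i\<close> lies in exactly one of \<open>S\<close> and
    \<open>T\<close>, so one factor is a coefficient omitting just \<open>i\<close>, which vanishes
    in the last case below.\<close>
  have coeff: "top_coeff ((S \<union> T) - {i}) (\<lambda>v. f v * g v) =
      top_coeff (S - {i}) f * top_coeff (T - {i}) g" for i
    unfolding Un_Diff using fin by (intro top_coeff_mult[OF mult.hyps(1-3)]) auto
  consider "annihilated S f" | "annihilated T g"
    | i t where "S = {i}" "slice i t f = (\<lambda>_. 0)"
    | i t where "T = {i}" "slice i t g = (\<lambda>_. 0)"
    | "\<forall>i\<in>S. top_coeff (S - {i}) f = 0" "\<forall>i\<in>T. top_coeff (T - {i}) g = 0"
    using mult.IH fin by blast
  then show ?case
  proof cases
    case 1
    then show ?thesis using mult_f by blast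
  next
    case 2
    then show ?thesis using mult_g mult.hyps(3) unfolding swap by (metis Int_commute Un_commute)
  next
    case 3
    show ?thesis
    proof (cases "T = {}")
      case True
      then show ?thesis using 3 slice_mult_left[OF mult.hyps(2), of i t f] by auto
    next
      case False
      then show ?thesis
        using 3 mult.hyps annihilated_mult_singleton[OF 3(2) mult.hyps(2)] by auto
    qed
  next
    case 4
    show ?thesis
    proof (cases "S = {}")
      case True
      then show ?thesis using 4 slice_mult_right[OF mult.hyps(1), of i t g] by auto
    next
      case False
      then show ?thesis
        using 4 mult.hyps annihilated_mult_singleton[OF 4(2) mult.hyps(1)] unfolding swap by auto
    qed
  next
    case 5
    then show ?thesis by (auto simp: coeff)
  qed
qed

text \<open>The target as a function on an arbitrary variable set, since the summands dictate which
  variables the induction removes.\<close>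

definition near_top :: "'a \<Rightarrow> 'a \<Rightarrow> nat set \<Rightarrow> (nat \<Rightarrow> 'a::field) \<Rightarrow> 'a" where
  "near_top \<alpha> \<beta> S v = \<alpha> * (\<Prod>i\<in>S. v i) + \<beta> * (\<Sum>i\<in>S. \<Prod>j\<in>S - {i}. v j)"

lemma near_top_insert:
  assumes "finite S" "i \<notin> S"
  shows "near_top \<alpha> \<beta> (insert i S) v = v i * near_top \<alpha> \<beta> S v + \<beta> * (\<Prod>j\<in>S. v j)"
proof -
  have "(\<Prod>j\<in>insert i S - {k}. v j) = v i * (\<Prod>j\<in>S - {k}. v j)" if "k \<in> S" for k
    using that assms by (subst insert_Diff_if) auto
  then have "(\<Sum>k\<in>S. \<Prod>j\<in>insert i S - {k}. v j) = v i * (\<Sum>k\<in>S. \<Prod>j\<in>S - {k}. v j)"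
    by (simp add: sum_distrib_left)
  then show ?thesis using assms by (simp add: near_top_def algebra_simps)
qed

text \<open>In the form \<open>x g + h\<close> with \<open>x = v i\<close>, \<open>g\<close> is the
  same kind of function on the rest and \<open>h\<close> is \<open>\<beta>\<close> times the
  remaining product. So \<open>t h\<close> only alters \<open>\<alpha>\<close>, and
  \<open>\<beta>\<close> stays nonzero throughout the induction.\<close>

lemma slice_near_top:
  fixes \<alpha> \<beta> :: "'a::field"
  assumes "finite S" "i \<in> S"
  shows "slice i t (near_top \<alpha> \<beta> S) = near_top (\<alpha> + t * \<beta>) \<beta> (S - {i})"
proof
  fix v :: "nat \<Rightarrow> 'a"
  define R where "R = S - {i}"
  have R: "S = insert i R" "finite R" "i \<notin> R" using assms by (auto simp: R_def)
  have prod: "(\<Prod>j\<in>A. (v(i := x)) j) = (\<Prod>j\<in>A. v j)" if "i \<notin> A" for A x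
    using that by (intro prod.cong) auto
  then have "near_top \<alpha> \<beta> R (v(i := x)) = near_top \<alpha> \<beta> R v" for x
    using R by (simp add: near_top_def)
  then have "slice i t (near_top \<alpha> \<beta> S) v = near_top \<alpha> \<beta> R v + t * \<beta> * (\<Prod>j\<in>R. v j)"
    using R prod by (simp add: slice_def near_top_insert algebra_simps)
  then show "slice i t (near_top \<alpha> \<beta> S) v = near_top (\<alpha> + t * \<beta>) \<beta> (S - {i}) v"
    by (simp add: near_top_def R_def[symmetric] algebra_simps)
qed

text \<open>At the 0/1 points involved \<open>v i = 0\<close>, so only the product omitting
  \<open>i\<close> can survive, and it does so exactly at \<open>T = R\<close>.\<close>

lemma top_coeff_near_top:
  fixes \<alpha> \<beta> :: "'a::field"
  assumes "finite S" "i \<in> S"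
  shows "top_coeff (S - {i}) (near_top \<alpha> \<beta> S) = \<beta>"
proof -
  define R where "R = S - {i}"
  have R: "S = insert i R" "finite R" "i \<notin> R" using assms by (auto simp: R_def)
  have "(\<Prod>j\<in>R. if j \<in> T then 1 else (0::'a)) = (if T = R then 1 else 0)" if "T \<subseteq> R" for T
    using R(2) that by (auto intro!: prod_zero prod.neutral)
  then have "near_top \<alpha> \<beta> S (\<lambda>j. if j \<in> T then 1 else 0) = (if T = R then \<beta> else 0)"
    if "T \<subseteq> R" for T
    using R that by (auto simp: near_top_insert)
  then have "top_coeff R (near_top \<alpha> \<beta> S) =
      (\<Sum>T\<in>Pow R. (-1) ^ card (R - T) * (if T = R then \<beta> else 0))"
    unfolding top_coeff_def by (intro sum.cong) auto
  also have "\<dots> = (\<Sum>T\<in>Pow R. if T = R then \<beta> else 0)"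
    by (intro sum.cong) auto
  also have "\<dots> = \<beta>" using R(2) by simp
  finally show ?thesis by (simp add: R_def)
qed

lemma slice_sum_list:
  "slice i t (\<lambda>v. \<Sum>f\<leftarrow>fs. f v) = (\<lambda>v. \<Sum>f\<leftarrow>map (slice i t) fs. f v)"
proof (induction fs)
  case Nil
  then show ?case by (simp add: slice_const)
next
  case (Cons f fs)
  then show ?case using slice_add[of i t f "\<lambda>v. \<Sum>f\<leftarrow>fs. f v"] by (simp add: o_def)
qed

lemma top_coeff_sum_list:
  "top_coeff S (\<lambda>v. \<Sum>f\<leftarrow>fs. f v) = (\<Sum>f\<leftarrow>fs. top_coeff S f)"
proof (induction fs)
  case Nil
  then show ?case by (simp add: top_coeff_def)
next
  case (Cons f fs)
  then show ?case using top_coeff_add[of S f "\<lambda>v. \<Sum>f\<leftarrow>fs. f v"] by simp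
qed

text \<open>Killing one summand costs two variables, so both sides of the cardinality bound drop by
  2. The operations change \<open>S\<close> and \<open>\<alpha>\<close>, hence both are
  generalized.\<close>

lemma near_top_neq_sum_read_once:
  fixes fs :: "((nat \<Rightarrow> 'a::field) \<Rightarrow> 'a) list"
  assumes "\<beta> \<noteq> 0" "finite S" "card S \<ge> 2 * length fs + 1" "\<forall>f\<in>set fs. read_once S f"
  shows "near_top \<alpha> \<beta> S \<noteq> (\<lambda>v. \<Sum>f\<leftarrow>fs. f v)"
  using assms(2-)
proof (induction "length fs" arbitrary: fs S \<alpha> rule: less_induct)
  case less
  show ?case
  proof
    assume eq: "near_top \<alpha> \<beta> S = (\<lambda>v. \<Sum>f\<leftarrow>fs. f v)"
    have "S \<noteq> {}" using less.prems by auto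
    then obtain i where "i \<in> S" by auto
    then have coeff: "(\<Sum>f\<leftarrow>fs. top_coeff (S - {i}) f) = \<beta>"
      using top_coeff_near_top[OF less.prems(1), of i \<alpha> \<beta>] unfolding eq top_coeff_sum_list by simp
    have "\<exists>f\<in>set fs. top_coeff (S - {i}) f \<noteq> 0"
    proof (rule ccontr)
      assume "\<not> ?thesis"
      then have "map (top_coeff (S - {i})) fs = map (\<lambda>_. 0) fs" by simp
      with coeff \<open>\<beta> \<noteq> 0\<close> show False by (simp add: map_replicate_const sum_list_replicate)
    qed
    then obtain f where f: "f \<in> set fs" "top_coeff (S - {i}) f \<noteq> 0" by blast
    \<comment> \<open>A nonempty list forces at least three variables, which excludes the singleton
      alternative of the trichotomy.\<close>
    then have "length fs \<noteq> 0" by auto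
    then have "card S \<noteq> 1" using less.prems(2) by linarith
    then have "\<nexists>i. S = {i}" by auto
    with f have "annihilated S f"
      using read_once_trichotomy[of S f] less.prems(1,3) \<open>i \<in> S\<close> by blast
    then obtain i j t where ij: "i \<in> S" "j \<in> S" "i \<noteq> j"
        and kill: "slice i 0 (slice j t f) = (\<lambda>_. 0)"
      unfolding annihilated_def by blast
    from f(1) obtain xs ys where fs: "fs = xs @ f # ys" by (meson split_list)
    define gs where "gs = map (\<lambda>g. slice i 0 (slice j t g)) (xs @ ys)"
    have "near_top (\<alpha> + t * \<beta>) \<beta> (S - {j} - {i}) = slice i 0 (slice j t (near_top \<alpha> \<beta> S))"
      using ij less.prems(1) by (simp add: slice_near_top)
    also have "\<dots> = (\<lambda>v. \<Sum>g\<leftarrow>gs. g v)"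
      unfolding eq slice_sum_list fs gs_def by (simp add: kill o_def)
    finally have "near_top (\<alpha> + t * \<beta>) \<beta> (S - {j} - {i}) = (\<lambda>v. \<Sum>g\<leftarrow>gs. g v)" .
    moreover have "card (S - {j} - {i}) = card S - 2"
      using ij less.prems(1) by (simp add: card_Diff_singleton)
    then have "card (S - {j} - {i}) \<ge> 2 * length gs + 1"
      using less.prems(2) by (simp add: gs_def fs)
    moreover have "\<forall>g\<in>set gs. read_once (S - {j} - {i}) g"
      using less.prems(3) by (auto simp: gs_def fs intro!: read_once_slice)
    ultimately show False
      using less.hyps[of gs "S - {j} - {i}" "\<alpha> + t * \<beta>"] less.prems(1) by (simp add: gs_def fs)
  qed
qed

section \<open>Upper bound\<close>

lemma Const_0: "Const 0 = 0" and Const_1: "Const 1 = 1"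
  by (simp_all add: Const_def)

lemma Const_add: "Const (a + b) = Const a + Const b"
  by (simp add: Const_def single_add)

lemma Const_mult: "Const (a * b) = Const a * Const b"
  by (simp add: Const_def mult_single)

lemma formula_times_prod_Var:
  assumes "finite T" "distinct (leaf_vars \<phi>)" "set (leaf_vars \<phi>) \<inter> T = {}"
  shows "\<exists>\<psi>. distinct (leaf_vars \<psi>) \<and> set (leaf_vars \<psi>) = set (leaf_vars \<phi>) \<union> T \<and>
    formula_poly \<psi> = formula_poly \<phi> * (\<Prod>i\<in>T. Var i)"
  using assms(1,3)
proof (induction T)
  case empty
  then show ?case using assms(2) by auto
next
  case (insert i T)
  then obtain \<psi> where \<psi>: "distinct (leaf_vars \<psi>)" "set (leaf_vars \<psi>) = set (leaf_vars \<phi>) \<union> T"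
      "formula_poly \<psi> = formula_poly \<phi> * (\<Prod>i\<in>T. Var i)"
    by auto
  show ?case
    by (rule exI[of _ "Times 1 0 \<psi> (Leaf i 1 0)"])
      (use \<psi> insert in \<open>auto simp: Const_0 Const_1 ac_simps\<close>)
qed

lemma is_rop_times_prod_Var:
  assumes "distinct (leaf_vars \<phi>)" "set (leaf_vars \<phi>) \<inter> T = {}" "set (leaf_vars \<phi>) \<union> T \<subseteq> {1..n}"
  shows "is_rop n (formula_poly \<phi> * (\<Prod>i\<in>T. Var i))"
proof -
  have "finite T" using assms(3) by (auto intro: finite_subset)
  from formula_times_prod_Var[OF this assms(1,2)] show ?thesis
    using assms(3) unfolding is_rop_def is_rof_def by metis
qed

lemma exists_formula_pair:
  fixes \<alpha> \<beta> :: "'a::field"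
  assumes "i \<noteq> j"
  shows "\<exists>\<phi>. distinct (leaf_vars \<phi>) \<and> set (leaf_vars \<phi>) = {i, j} \<and>
    formula_poly \<phi> = Const \<alpha> * (Var i * Var j) + Const \<beta> * (Var i + Var j)"
proof (cases "\<alpha> = 0")
  case True
  then show ?thesis using assms
    by (intro exI[of _ "Plus \<beta> 0 (Leaf i 1 0) (Leaf j 1 0)"]) (simp add: Const_0 Const_1)
next
  case False
  let ?\<gamma> = "\<beta> / \<alpha>"
  have "Const \<alpha> * Const ?\<gamma> = Const \<beta>"
    using False by (simp flip: Const_mult)
  moreover have "Const \<alpha> * (Const ?\<gamma> * Const ?\<gamma>) + Const (- (\<alpha> * (?\<gamma> * ?\<gamma>))) = 0"
    by (simp add: Const_0 flip: Const_mult Const_add)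
  moreover have "a * ((x + g) * (y + g)) + c = a * (x * y) + b * (x + y)"
    if "a * g = b" "a * (g * g) + c = 0" for a b c g x y :: "'a mpoly"
  proof -
    have "a * ((x + g) * (y + g)) + c = a * (x * y) + a * g * (x + y) + (a * (g * g) + c)"
      by (simp add: algebra_simps)
    then show ?thesis by (simp add: that)
  qed
  ultimately show ?thesis using assms
    by (intro exI[of _ "Times \<alpha> (- (\<alpha> * (?\<gamma> * ?\<gamma>))) (Leaf i 1 ?\<gamma>) (Leaf j 1 ?\<gamma>)"])
      (simp add: Const_1)
qed

text \<open>All monomials share the product of the variables other than \<open>i\<close> and
  \<open>j\<close>; the cofactor is the pair formula.\<close>

lemma is_rop_pair:
  assumes "i \<in> {1..n}" "j \<in> {1..n}" "i \<noteq> j"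
  shows "is_rop n (Const \<alpha> * (\<Prod>l\<in>{1..n}. Var l) +
    Const \<beta> * (\<Sum>l\<in>{i, j}. \<Prod>m\<in>{1..n} - {l}. Var m))"
proof -
  define R where "R = {1..n} - {i, j}"
  have R: "finite R" "i \<notin> R" "j \<notin> R" by (auto simp: R_def)
  have "{1..n} = insert i (insert j R)" "{1..n} - {i} = insert j R" "{1..n} - {j} = insert i R"
    using assms by (auto simp: R_def)
  then have eq: "Const \<alpha> * (\<Prod>l\<in>{1..n}. Var l) +
      Const \<beta> * (\<Sum>l\<in>{i, j}. \<Prod>m\<in>{1..n} - {l}. Var m) =
      (Const \<alpha> * (Var i * Var j) + Const \<beta> * (Var i + Var j)) * (\<Prod>l\<in>R. Var l)"
    using R assms(3) by (simp add: algebra_simps)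
  from exists_formula_pair[OF assms(3), of \<alpha> \<beta>] obtain \<phi> where
    "distinct (leaf_vars \<phi>)" "set (leaf_vars \<phi>) = {i, j}"
    "formula_poly \<phi> = Const \<alpha> * (Var i * Var j) + Const \<beta> * (Var i + Var j)" by blast
  then show ?thesis
    unfolding eq using is_rop_times_prod_Var[of \<phi> R n] assms by (auto simp: R_def)
qed

text \<open>Serves the index left over when the number of indices is odd: the leaf
  \<open>\<alpha> x + \<beta>\<close>, with \<open>x\<close> the variable of index \<open>i\<close>,
  times the other variables.\<close>

lemma is_rop_single:
  assumes "i \<in> {1..n}"
  shows "is_rop n (Const \<alpha> * (\<Prod>l\<in>{1..n}. Var l) + Const \<beta> * (\<Prod>m\<in>{1..n} - {i}. Var m))"
proof -
  have "Const \<alpha> * (\<Prod>l\<in>{1..n}. Var l) + Const \<beta> * (\<Prod>m\<in>{1..n} - {i}. Var m) =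
      formula_poly (Leaf i \<alpha> \<beta>) * (\<Prod>m\<in>{1..n} - {i}. Var m)"
    using assms by (simp add: prod.remove algebra_simps del: One_nat_def)
  then show ?thesis
    using is_rop_times_prod_Var[of "Leaf i \<alpha> \<beta>" "{1..n} - {i}" n] assms by auto
qed

text \<open>Pairs are split off with 0 in place of \<open>\<alpha>\<close>; the last group, of one
  or two indices, carries the full product. Nonemptiness of \<open>S\<close> guarantees such a group
  and rules out \<open>m = 0\<close>.\<close>

lemma sum_of_at_most_rops_subset:
  assumes "S \<subseteq> {1..n}" "S \<noteq> {}" "card S \<le> 2 * m"
  shows "sum_of_at_most_rops n m
    (Const \<alpha> * (\<Prod>l\<in>{1..n}. Var l) + Const \<beta> * (\<Sum>i\<in>S. \<Prod>j\<in>{1..n} - {i}. Var j))"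
  using assms
proof (induction m arbitrary: S)
  case 0
  then show ?case by (auto dest: finite_subset)
next
  case (Suc m)
  let ?p = "\<lambda>\<alpha> S. Const \<alpha> * (\<Prod>l\<in>{1..n}. Var l) +
    Const \<beta> * (\<Sum>i\<in>S. \<Prod>j\<in>{1..n} - {i}. Var j)"
  have fin: "finite S" using Suc.prems finite_subset by blast
  have "card S \<noteq> 0" using fin Suc.prems by simp
  then consider "card S = 1" | "card S = 2" | "card S > 2" by linarith
  then show ?case
  proof cases
    case 1
    then obtain i where "S = {i}" by (auto simp: card_1_singleton_iff)
    then have "is_rop n (?p \<alpha> S)" using is_rop_single[of i n \<alpha> \<beta>] Suc.prems by simp
    then show ?thesis unfolding sum_of_at_most_rops_def by (intro exI[of _ "[?p \<alpha> S]"]) simp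
  next
    case 2
    then obtain i j where "S = {i, j}" "i \<noteq> j" by (auto simp: card_2_iff)
    then have "is_rop n (?p \<alpha> S)" using is_rop_pair[of i n j \<alpha> \<beta>] Suc.prems by simp
    then show ?thesis unfolding sum_of_at_most_rops_def by (intro exI[of _ "[?p \<alpha> S]"]) simp
  next
    case 3
    then obtain P where P: "P \<subseteq> S" "card P = 2"
      by (metis obtain_subset_with_card_n less_imp_le)
    then obtain i j where ij: "P = {i, j}" "i \<noteq> j" by (auto simp: card_2_iff)
    have card: "card (S - P) = card S - 2"
      using P fin by (metis card_Diff_subset finite_subset)
    then have "S - P \<noteq> {}" using 3 by force
    then have "sum_of_at_most_rops n m (?p \<alpha> (S - P))"
      using Suc.prems card by (intro Suc.IH) auto
    then obtain ps where ps: "length ps \<le> m" "\<forall>q\<in>set ps. is_rop n q" "?p \<alpha> (S - P) = sum_list ps"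
      unfolding sum_of_at_most_rops_def by blast
    have "is_rop n (?p 0 P)" unfolding ij using ij P Suc.prems by (intro is_rop_pair) auto
    moreover have "?p \<alpha> S = ?p 0 P + ?p \<alpha> (S - P)"
      by (simp add: sum.subset_diff[OF P(1) fin] Const_0 distrib_left)
    ultimately show ?thesis
      unfolding sum_of_at_most_rops_def using ps by (intro exI[of _ "?p 0 P # ps"]) simp
  qed
qed

theorem theorem7:
  fixes \<alpha> \<beta> :: "'a::field" and n k :: nat
  assumes "n \<ge> 1" and "\<beta> \<noteq> 0" and "k = nat \<lceil>real n / 2\<rceil>"
  shows "sum_of_at_most_rops n k
           (Const \<alpha> * elem_sym n n + Const \<beta> * elem_sym n (n - 1))
       \<and> \<not> sum_of_at_most_rops n (k - 1)
           (Const \<alpha> * elem_sym n n + Const \<beta> * elem_sym n (n - 1))"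
proof
  \<comment> \<open>Since \<open>n \<ge> 1\<close> gives \<open>k \<ge> 1\<close>, the subtraction
    \<open>k - 1\<close> is not truncated.\<close>
  have k: "n \<le> 2 * k" "2 * (k - 1) + 1 \<le> n"
    using assms(1,3) by linarith+
  let ?p = "Const \<alpha> * elem_sym n n + Const \<beta> * elem_sym n (n - 1)"
  show "sum_of_at_most_rops n k ?p"
    unfolding elem_sym_full elem_sym_pred[OF assms(1)]
    by (rule sum_of_at_most_rops_subset) (use assms(1) k in auto)
  show "\<not> sum_of_at_most_rops n (k - 1) ?p"
  proof
    assume "sum_of_at_most_rops n (k - 1) ?p"
    then obtain ps where ps: "length ps \<le> k - 1" "\<forall>q\<in>set ps. is_rop n q" "?p = sum_list ps"
      unfolding sum_of_at_most_rops_def by blast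
    \<comment> \<open>Equal polynomials have equal evaluations, so refuting equality of functions
      suffices, over finite fields too.\<close>
    have "peval ?p = near_top \<alpha> \<beta> {1..n}"
      by (simp add: fun_eq_iff elem_sym_full elem_sym_pred[OF assms(1)] peval_add peval_mult
          peval_Const peval_sum peval_prod_Var near_top_def del: One_nat_def)
    moreover have "peval ?p = (\<lambda>v. \<Sum>f\<leftarrow>map peval ps. f v)"
      unfolding ps(3) by (simp add: fun_eq_iff peval_sum_list o_def)
    moreover have "near_top \<alpha> \<beta> {1..n} \<noteq> (\<lambda>v. \<Sum>f\<leftarrow>map peval ps. f v)"
      using ps(1,2) k assms(2)
      by (intro near_top_neq_sum_read_once) (auto simp del: One_nat_def intro: read_once_is_rop)
    ultimately show False by simp
  qed
qed

end
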